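(* Let $B\in\mathcal{B}^N_{\mathrm{hLag}}(v,\rho)$, i.e. $B=(b_1,\ldots,b_N)$ is the vector of $\rho$-barycenters of some hierarchical Laguerre tessellation with $\rho$-volumes $v$. Then there exists a unique collection of probability measures $(\theta_i)_{i=1}^N\subset\mathcal{P}_1(\mathbb{R}^d)$ such that $$\sum_{i=1}^N v_i\theta_i=\rho,\qquad \int_{\mathbb{R}^d}x\,d\theta_i(x)=b_i\quad\forall i=1,\ldots,N.$$ In particular, identifying tessellations whose corresponding cells agree up to $\rho$-null sets, there exists a unique tessellation $(P_i)_{i=1}^N$ of $\mathbb{R}^d$ with $\rho(P_i)=v_i$ and $\frac{1}{v_i}\int_{P_i}x\,d\rho(x)=b_i$ for all $i$, and therefore it must be a hierarchical Laguerre tessellation.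
   Context: Let $d,N\ge 1$ be integers. $\mathcal{P}_1(\mathbb{R}^d)$ denotes the Borel probability measures on $\mathbb{R}^d$ with finite first moment. $\rho\in\mathcal{P}_1(\mathbb{R}^d)$ is absolutely continuous with respect to Lebesgue measure with bounded density, and $v\in\mathbb{R}_{>0}^N$ satisfies $\sum_i v_i=1$. A (convex) tessellation of $\mathbb{R}^d$ is a list $(P_1,\ldots,P_N)$ of (possibly empty) closed convex sets (cells) with pairwise disjoint interiors and $\bigcup_iP_i=\mathbb{R}^d$. Laguerre tessellation with $M$ cells: for pairwise distinct points $y_1,\ldots,y_M\in\mathbb{R}^d$ and weights $\phi\in\mathbb{R}^M$, the list of cells $L_i=\{x\in\mathbb{R}^d:\langle x,y_i\rangle-\phi_i\ge\langle x,y_j\rangle-\phi_j\ \forall j\ne i\}$, $i=1,\ldots,M$. Hierarchical Laguerre tessellation, defined recursively: every Laguerre tessellation is one; and if $(P_i)_{1\le i\le N'}$ is a hierarchical Laguerre tessellation and $(Q_j)_{1\le j\le M}$ is a Laguerre tessellation, then for any $i_0$ the tessellation with $N'+M-1$ cells $P_1,\ldots,P_{i_0-1},P_{i_0}\cap Q_1,\ldots,P_{i_0}\cap Q_M,P_{i_0+1},\ldots,P_{N'}$ is one. The cells may be relabelled by any permutation. $\mathcal{B}^N_{\mathrm{hLag}}(v,\rho)$ is the set of $B\in(\mathbb{R}^d)^N$ for which there is a hierarchical Laguerre tessellation $(L_i)_{i=1}^N$ with $\rho(L_i)=v_i$ and $b_i=\frac1{v_i}\int_{L_i}x\,d\rho(x)$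 for all $i$. *)

theory Defs
  imports "HOL-Probability.Probability"
begin

definition P1 :: "'a::euclidean_space measure set" where
  "P1 = {\<mu>. prob_space \<mu> \<and> sets \<mu> = sets borel \<and> integrable \<mu> (\<lambda>x. norm x)}"

definition bounded_density :: "'a::euclidean_space measure \<Rightarrow> bool" where
  "bounded_density \<rho> \<longleftrightarrow>
    (\<exists>f C. f \<in> borel_measurable borel \<and> (\<forall>x. 0 \<le> f x \<and> f x \<le> (C::real)) \<and>
       \<rho> = density lborel (\<lambda>x. ennreal (f x)))"

text \<open>Tuples are lists, so that the index \<open>i = 1, \<dots>, N\<close> becomes \<open>i < N\<close> and
  two tuples are equal exactly when all their \<open>N\<close> entries are.\<close>

definition tessellation :: "'a::euclidean_space set list \<Rightarrow> bool" where
  "tessellation P \<longleftrightarrow>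
    (\<forall>i<length P. closed (P ! i) \<and> convex (P ! i)) \<and>
    (\<forall>i<length P. \<forall>j<length P. i \<noteq> j \<longrightarrow> interior (P ! i) \<inter> interior (P ! j) = {}) \<and>
    (\<Union>i<length P. P ! i) = UNIV"

definition laguerre_cell :: "'a::euclidean_space list \<Rightarrow> real list \<Rightarrow> nat \<Rightarrow> 'a set" where
  "laguerre_cell y \<phi> i =
    {x. \<forall>j<length y. j \<noteq> i \<longrightarrow> x \<bullet> (y ! i) - \<phi> ! i \<ge> x \<bullet> (y ! j) - \<phi> ! j}"

definition laguerre :: "'a::euclidean_space set list \<Rightarrow> bool" where
  "laguerre L \<longleftrightarrow>
    (\<exists>y \<phi>. y \<noteq> [] \<and> distinct y \<and> length \<phi> = length y \<and>
       L = map (laguerre_cell y \<phi>) [0..<length y])"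

inductive hier_laguerre :: "'a::euclidean_space set list \<Rightarrow> bool" where
  base: "laguerre L \<Longrightarrow> hier_laguerre L"
| refine: "hier_laguerre P \<Longrightarrow> laguerre Q \<Longrightarrow> i < length P \<Longrightarrow>
    hier_laguerre (take i P @ map (\<lambda>C. P ! i \<inter> C) Q @ drop (Suc i) P)"
| relabel: "hier_laguerre P \<Longrightarrow> mset P' = mset P \<Longrightarrow> hier_laguerre P'"

definition has_volumes_barycenters ::
  "'a::euclidean_space measure \<Rightarrow> real list \<Rightarrow> 'a list \<Rightarrow> 'a set list \<Rightarrow> bool" where
  "has_volumes_barycenters \<rho> v B P \<longleftrightarrow>
    length P = length v \<and> length B = length v \<and>
    (\<forall>i<length v. measure \<rho> (P ! i) = v ! i \<and>
       B ! i = (1 / v ! i) *\<^sub>R (LINT x:(P ! i)|\<rho>. x))"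

definition B_hLag :: "nat \<Rightarrow> real list \<Rightarrow> 'a::euclidean_space measure \<Rightarrow> 'a list set" where
  "B_hLag N v \<rho> =
    {B. length B = N \<and> (\<exists>L. hier_laguerre L \<and> length L = N \<and> has_volumes_barycenters \<rho> v B L)}"

definition agree_upto_null ::
  "'a::euclidean_space measure \<Rightarrow> 'a set list \<Rightarrow> 'a set list \<Rightarrow> bool" where
  "agree_upto_null \<rho> P P' \<longleftrightarrow>
    length P = length P' \<and> (\<forall>i<length P. sym_diff (P ! i) (P' ! i) \<in> null_sets \<rho>)"

end

theory Submission
  imports Defs "HOL-Combinatorics.Permutations"
begin

text \<open>A competitor \<open>\<theta>\<close> is encoded by the densities \<open>g\<^sub>i = v\<^sub>i d\<theta>\<^sub>i / d\<rho>\<close>, which sum to \<open>1\<close>; the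
  claim becomes that \<open>g\<^sub>i\<close> is the indicator of the cell \<open>L\<^sub>i\<close>. For a Laguerre tessellation
  with potentials \<open>h\<^sub>i(x) = \<langle>x, y\<^sub>i\<rangle> - \<phi>\<^sub>i\<close>, the moment constraints force
  \<open>\<Sum>\<^sub>i \<integral> g\<^sub>i h\<^sub>i d\<rho> = \<integral> max\<^sub>i h\<^sub>i d\<rho>\<close>, so \<open>g\<^sub>i\<close> vanishes almost everywhere that \<open>h\<^sub>i\<close> is not maximal.
  For a refinement of one cell, summing the densities of its pieces gives a competitor for
  the coarser tessellation, and the Laguerre argument applies again inside that cell.\<close>

section \<open>Geometry: hierarchical Laguerre lists are tessellations\<close>

lemma tessellation_measurable:
  "tessellation P \<Longrightarrow> i < length P \<Longrightarrow> P ! i \<in> sets borel"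
  unfolding tessellation_def by auto

text \<open>Disjointness of the interiors pushes the overlap into the two frontiers, and the
  frontier of a convex set is Lebesgue negligible.\<close>

lemma tessellation_overlap_negligible:
  fixes P :: "'a::euclidean_space set list"
  assumes "tessellation P" "i < length P" "j < length P" "i \<noteq> j"
  shows "negligible (P ! i \<inter> P ! j)"
proof -
  have *: "closed (P ! k)" "convex (P ! k)" if "k \<in> {i, j}" for k
    using assms that unfolding tessellation_def by auto
  have disj: "interior (P ! i) \<inter> interior (P ! j) = {}"
    using assms unfolding tessellation_def by simp
  have "P ! i \<inter> P ! j \<subseteq> frontier (P ! i) \<union> frontier (P ! j)"
    using closure_subset[of "P ! i"] closure_subset[of "P ! j"] disj unfolding frontier_def by blast
  moreover have "negligible (frontier (P ! i) \<union> frontier (P ! j))"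
    using * by (intro negligible_Un negligible_convex_frontier) auto
  ultimately show ?thesis
    using negligible_subset by blast
qed

text \<open>Each cell is a finite intersection of closed half-spaces. Two cells meet only where
  their affine functions \<open>?h i\<close> and \<open>?h j\<close> agree; since the points of
  \<open>y\<close> are distinct, this is a genuine hyperplane with empty interior. An index
  maximising \<open>?h i x\<close> provides a cell containing \<open>x\<close>.\<close>

lemma laguerre_tessellation:
  fixes L :: "'a::euclidean_space set list"
  assumes "laguerre L"
  shows "tessellation L"
proof -
  obtain y \<phi> where y: "y \<noteq> []" "distinct y"
    and L: "L = map (laguerre_cell y \<phi>) [0..<length y]"
    using assms unfolding laguerre_def by auto
  let ?h = "\<lambda>i x. x \<bullet> (y ! i) - \<phi> ! i"
  have cell: "L ! i = (\<Inter>j\<in>{j. j < length y \<and> j \<noteq> i}. {x. (y ! j - y ! i) \<bullet> x \<le> \<phi> ! j - \<phi> ! i})"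
    if "i < length y" for i
    using that by (auto simp: L laguerre_cell_def algebra_simps inner_commute)
  show ?thesis
    unfolding tessellation_def
  proof (intro conjI allI impI)
    fix i assume "i < length L"
    then have i: "i < length y" by (simp add: L)
    show "closed (L ! i)" unfolding cell[OF i]
      by (intro closed_INT ballI closed_halfspace_le)
    show "convex (L ! i)" unfolding cell[OF i]
      by (intro convex_INT convex_halfspace_le)
  next
    fix i j assume "i < length L" "j < length L" "i \<noteq> j"
    then have ij: "i < length y" "j < length y" "i \<noteq> j" by (auto simp: L)
    then have "y ! j - y ! i \<noteq> 0" using y by (simp add: nth_eq_iff_index_eq)
    then have "interior {x. (y ! j - y ! i) \<bullet> x = \<phi> ! j - \<phi> ! i} = {}"
      by (rule interior_hyperplane)
    moreover have "L ! i \<inter> L ! j \<subseteq> {x. (y ! j - y ! i) \<bullet> x = \<phi> ! j - \<phi> ! i}"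
    proof
      fix x assume x: "x \<in> L ! i \<inter> L ! j"
      have "?h j x \<le> ?h i x" "?h i x \<le> ?h j x"
        using x ij by (auto simp: L laguerre_cell_def)
      then show "x \<in> {x. (y ! j - y ! i) \<bullet> x = \<phi> ! j - \<phi> ! i}"
        by (simp add: algebra_simps inner_commute)
    qed
    ultimately show "interior (L ! i) \<inter> interior (L ! j) = {}"
      by (metis interior_Int interior_mono subset_empty)
  next
    show "(\<Union>i<length L. L ! i) = UNIV"
    proof (intro set_eqI iffI UNIV_I)
      fix x
      have "finite ((\<lambda>i. ?h i x) ` {..<length y})" "(\<lambda>i. ?h i x) ` {..<length y} \<noteq> {}"
        using y by auto
      from Max_in[OF this] obtain i where "i < length y"
        "?h i x = Max ((\<lambda>i. ?h i x) ` {..<length y})"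
        by auto
      then have "x \<in> L ! i"
        by (auto simp: L laguerre_cell_def)
      then show "x \<in> (\<Union>i<length L. L ! i)"
        using \<open>i < length y\<close> by (auto simp: L)
    qed
  qed
qed

text \<open>An index-free form that decomposes along \<open>@\<close>, which suits the refinement
  step. Disjointness is symmetric, so testing it for pairs in list order suffices.\<close>

lemma tessellation_iff_sorted_wrt:
  "tessellation P \<longleftrightarrow> (\<forall>C\<in>set P. closed C \<and> convex C) \<and>
    sorted_wrt (\<lambda>C D. interior C \<inter> interior D = {}) P \<and> \<Union> (set P) = UNIV"
proof -
  have "(\<forall>i<length P. \<forall>j<length P. i \<noteq> j \<longrightarrow> interior (P ! i) \<inter> interior (P ! j) = {}) \<longleftrightarrow>
    sorted_wrt (\<lambda>C D. interior C \<inter> interior D = {}) P" (is "?L \<longleftrightarrow> ?R")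
  proof
    assume ?L
    then show ?R by (simp add: sorted_wrt_iff_nth_less)
  next
    assume R: ?R
    show ?L
    proof (intro allI impI)
      fix i j assume "i < length P" "j < length P" "i \<noteq> j"
      then consider "i < j" | "j < i" by linarith
      then show "interior (P ! i) \<inter> interior (P ! j) = {}"
      proof cases
        case 1
        then show ?thesis using R \<open>j < length P\<close> by (simp add: sorted_wrt_iff_nth_less)
      next
        case 2
        then have "interior (P ! j) \<inter> interior (P ! i) = {}"
          using R \<open>i < length P\<close> by (simp add: sorted_wrt_iff_nth_less)
        then show ?thesis by (simp only: Int_commute)
      qed
    qed
  qed
  moreover have "\<Union> (set P) = (\<Union>i<length P. P ! i)"
    by (auto simp: set_conv_nth)
  ultimately show ?thesis
    by (simp only: tessellation_def all_set_conv_all_nth)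
qed

lemma tessellation_relabel:
  assumes "tessellation P" "mset P' = mset P"
  shows "tessellation P'"
proof -
  obtain p where p: "p permutes {..<length P}" and P': "P' = permute_list p P"
    using mset_eq_permutation[OF assms(2)] by metis
  have len: "length P' = length P" using assms(2) by (rule mset_eq_length)
  have nth: "P' ! i = P ! p i" "p i < length P" if "i < length P" for i
    using that p permutes_in_image[OF p, of i] by (auto simp: P' permute_list_nth)
  have inj: "p i = p j \<longleftrightarrow> i = j" for i j
    using permutes_inj[OF p] by (auto simp: inj_def)
  have "(\<Union>i<length P'. P' ! i) = \<Union> (set P')"
    by (auto simp: set_conv_nth)
  also have "\<dots> = \<Union> (set P)"
    using assms(2) by (metis set_mset_mset)
  also have "\<dots> = UNIV"
    using assms(1) by (simp add: tessellation_iff_sorted_wrt)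
  finally show ?thesis
    using assms(1) by (auto simp: tessellation_def len nth inj)
qed

text \<open>Both kinds of disjointness are inherited because the interior of
  \<open>S \<inter> C\<close> lies in the interiors of \<open>S\<close> and of \<open>C\<close>. The
  pieces cover \<open>S\<close> because the cells of \<open>Q\<close> cover the whole space.\<close>

lemma tessellation_refine:
  fixes P Q :: "'a::euclidean_space set list"
  assumes "tessellation P" "tessellation Q" "i < length P"
  shows "tessellation (take i P @ map (\<lambda>C. P ! i \<inter> C) Q @ drop (Suc i) P)"
proof -
  define A S B where "A = take i P" and "S = P ! i" and "B = drop (Suc i) P"
  have P: "P = A @ S # B"
    unfolding A_def S_def B_def using assms(3) by (rule id_take_nth_drop)
  have sub: "sorted_wrt (\<lambda>C D. interior (S \<inter> C) \<inter> interior (S \<inter> D) = {}) Q"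
    using assms(2) unfolding tessellation_iff_sorted_wrt
    by (auto elim!: sorted_wrt_mono_rel[rotated])
  have "S = (\<Union>C\<in>set Q. S \<inter> C)"
    using assms(2) unfolding tessellation_iff_sorted_wrt by blast
  then have un: "\<Union> (set A) \<union> (\<Union>C\<in>set Q. S \<inter> C) \<union> \<Union> (set B) = UNIV"
    using assms(1) unfolding tessellation_iff_sorted_wrt P
    by (metis Un_assoc Union_Un_distrib Union_insert list.set(2) set_append)
  have Pt: "\<forall>C\<in>set A \<union> {S} \<union> set B. closed C \<and> convex C"
    "sorted_wrt (\<lambda>C D. interior C \<inter> interior D = {}) (A @ S # B)"
    using assms(1) unfolding tessellation_iff_sorted_wrt P by auto
  have disj: "interior C \<inter> interior (S \<inter> D) = {}" "interior (S \<inter> D) \<inter> interior C = {}"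
    if "interior C \<inter> interior S = {} \<or> interior S \<inter> interior C = {}" for C D :: "'a set"
    using that by auto
  have "\<forall>C\<in>set Q. closed C \<and> convex C"
    using assms(2) unfolding tessellation_iff_sorted_wrt by blast
  then have "\<forall>C\<in>set (A @ map (\<lambda>C. S \<inter> C) Q @ B). closed C \<and> convex C"
    using Pt(1) by (auto intro: closed_Int convex_Int)
  moreover have "sorted_wrt (\<lambda>C D. interior C \<inter> interior D = {}) (A @ map (\<lambda>C. S \<inter> C) Q @ B)"
    using Pt(2) sub disj by (simp add: sorted_wrt_append sorted_wrt_map ball_Un)
  moreover have "\<Union> (set (A @ map (\<lambda>C. S \<inter> C) Q @ B)) = UNIV"
    using un by (simp add: Un_assoc)
  ultimately show ?thesis
    unfolding A_def[symmetric] S_def[symmetric] B_def[symmetric] tessellation_iff_sorted_wrt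
    by blast
qed

lemma hier_laguerre_tessellation:
  "hier_laguerre L \<Longrightarrow> tessellation L"
proof (induction rule: hier_laguerre.induct)
  case (base L)
  then show ?case by (rule laguerre_tessellation)
next
  case (refine P Q i)
  then show ?case by (simp add: tessellation_refine laguerre_tessellation)
next
  case (relabel P P')
  then show ?case by (metis tessellation_relabel)
qed

section \<open>Absolutely continuous measures and densities matching the moments of a cell\<close>

locale ac_P1 =
  fixes \<rho> :: "'a::euclidean_space measure"
  assumes in_P1: "\<rho> \<in> P1"
    and abs_cont: "absolutely_continuous lborel \<rho>"
begin

sublocale prob_space \<rho>
  using in_P1 by (simp add: P1_def)

lemma sets_rho [measurable_cong, simp]: "sets \<rho> = sets borel"
  and space_rho [simp]: "space \<rho> = UNIV"
  and integrable_norm_rho: "integrable \<rho> norm"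
  using in_P1 sets_eq_imp_space_eq[of \<rho> borel] by (auto simp: P1_def)

text \<open>Negligibility refers to the completed Lebesgue measure; for a Borel set it amounts to
  being \<open>lborel\<close>-null, where absolute continuity applies.\<close>

lemma negligible_imp_null:
  assumes "negligible S" "S \<in> sets borel"
  shows "S \<in> null_sets \<rho>"
  using assms abs_cont
  by (auto simp: negligible_iff_null_sets null_sets_completion_iff absolutely_continuous_def)

text \<open>The pairwise overlaps are finitely many null sets, and a point outside all of them lies
  in exactly one cell.\<close>

lemma AE_sum_indicator_tessellation:
  assumes "tessellation P"
  shows "AE x in \<rho>. (\<Sum>i<length P. indicator (P ! i) x) = (1::real)"
proof -
  let ?N = "\<lambda>i j. P ! i \<inter> P ! j"
  have "AE x in \<rho>. \<forall>(i, j)\<in>{(i, j). i < length P \<and> j < length P \<and> i \<noteq> j}. x \<notin> ?N i j"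
  proof (intro AE_finite_allI)
    show "finite {(i, j). i < length P \<and> j < length P \<and> i \<noteq> j}"
      by (rule finite_subset[of _ "{..<length P} \<times> {..<length P}"]) auto
    fix ij assume "ij \<in> {(i, j). i < length P \<and> j < length P \<and> i \<noteq> j}"
    then obtain i j where ij: "ij = (i, j)" "i < length P" "j < length P" "i \<noteq> j" by auto
    have "?N i j \<in> null_sets \<rho>"
      using assms ij tessellation_measurable[of P]
      by (intro negligible_imp_null tessellation_overlap_negligible) auto
    from AE_not_in[OF this] show "AE x in \<rho>. case ij of (i, j) \<Rightarrow> x \<notin> ?N i j"
      by (simp add: ij)
  qed
  then show ?thesis
  proof eventually_elim
    case (elim x)
    obtain k where k: "k < length P" "x \<in> P ! k"
      using assms unfolding tessellation_def by blast
    have "(\<Sum>i<length P. indicator (P ! i) x) = (\<Sum>i<length P. if i = k then 1 else 0 :: real)"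
      using elim k by (intro sum.cong) (auto split: split_indicator)
    also have "\<dots> = 1" using k by simp
    finally show ?case .
  qed
qed

text \<open>The constraints on a competing density \<open>g\<close> for the cell \<open>C\<close>:
  same mass and same unnormalised first moment as the indicator of \<open>C\<close>. Integrability
  is supplied separately, by an almost everywhere bound \<open>g x \<le> 1\<close>.\<close>

definition moments_match :: "('a \<Rightarrow> real) \<Rightarrow> 'a set \<Rightarrow> bool" where
  "moments_match g C \<longleftrightarrow> g \<in> borel_measurable borel \<and> (\<forall>x. 0 \<le> g x) \<and>
    (LINT x|\<rho>. g x) = measure \<rho> C \<and> (LINT x|\<rho>. g x *\<^sub>R x) = (LINT x:C|\<rho>. x)"

lemma integrable_bounded_density:
  fixes g :: "'a \<Rightarrow> real"
  assumes [measurable]: "g \<in> borel_measurable borel"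
    and "\<And>x. 0 \<le> g x" "AE x in \<rho>. g x \<le> 1"
  shows "integrable \<rho> g" "integrable \<rho> (\<lambda>x. g x *\<^sub>R x)"
proof -
  show "integrable \<rho> g"
    by (rule Bochner_Integration.integrable_bound[of _ "\<lambda>x. 1::real"])
      (use assms in auto)
  have "AE x in \<rho>. norm (g x *\<^sub>R x) \<le> norm (norm x)"
    using assms(3) by eventually_elim (use assms(2) in \<open>auto simp: mult_left_le_one_le\<close>)
  then show "integrable \<rho> (\<lambda>x. g x *\<^sub>R x)"
    by (intro Bochner_Integration.integrable_bound[OF integrable_norm_rho]) auto
qed

lemma moments_match_integrable:
  assumes "moments_match g C" "AE x in \<rho>. g x \<le> 1"
  shows "integrable \<rho> g" "integrable \<rho> (\<lambda>x. g x *\<^sub>R x)"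
proof -
  have "g \<in> borel_measurable borel" "\<And>x. 0 \<le> g x"
    using assms(1) by (simp_all add: moments_match_def)
  then show "integrable \<rho> g" "integrable \<rho> (\<lambda>x. g x *\<^sub>R x)"
    using assms(2) by (rule integrable_bounded_density)+
qed

lemma moments_match_indicator:
  "C \<in> sets borel \<Longrightarrow> moments_match (indicator C) C"
  by (auto simp: moments_match_def set_lebesgue_integral_def)

text \<open>Turns competing densities for the pieces of a refined cell \<open>S\<close> into one
  competing density for \<open>S\<close>. Masses and moments add up because the sets
  \<open>S \<inter> Q ! i\<close> partition \<open>S\<close> up to null sets.\<close>

lemma moments_match_merge:
  assumes Q: "tessellation Q" and S[measurable]: "S \<in> sets borel"
    and g: "\<And>i. i < length Q \<Longrightarrow> moments_match (g i) (S \<inter> Q ! i)"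
      "\<And>i. i < length Q \<Longrightarrow> AE x in \<rho>. g i x \<le> 1"
  shows "moments_match (\<lambda>x. \<Sum>i<length Q. g i x) S"
proof -
  have mQ[measurable]: "Q ! i \<in> sets borel" if "i < length Q" for i
    using tessellation_measurable[OF Q that] .
  have int: "integrable \<rho> (g i)" "integrable \<rho> (\<lambda>x. g i x *\<^sub>R x)" if "i < length Q" for i
    using moments_match_integrable[OF g[OF that]] by simp_all
  have int_ind: "integrable \<rho> (indicat_real (S \<inter> Q ! i))"
    "integrable \<rho> (\<lambda>x. indicat_real (S \<inter> Q ! i) x *\<^sub>R x)" if "i < length Q" for i
  proof -
    have "S \<inter> Q ! i \<in> sets borel" using that by measurable
    from moments_match_integrable[OF moments_match_indicator[OF this]]
    show "integrable \<rho> (indicat_real (S \<inter> Q ! i))"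
      "integrable \<rho> (\<lambda>x. indicat_real (S \<inter> Q ! i) x *\<^sub>R x)"
      by (simp_all add: indicator_le_1)
  qed
  have AE: "AE x in \<rho>. (\<Sum>i<length Q. indicator (S \<inter> Q ! i) x) = indicat_real S x"
    using AE_sum_indicator_tessellation[OF Q]
    by eventually_elim (simp add: indicator_inter_arith flip: sum_distrib_left)
  have "(LINT x|\<rho>. (\<Sum>i<length Q. g i x)) = (\<Sum>i<length Q. measure \<rho> (S \<inter> Q ! i))"
    using g int by (subst Bochner_Integration.integral_sum) (auto simp: moments_match_def)
  also have "\<dots> = (LINT x|\<rho>. (\<Sum>i<length Q. indicator (S \<inter> Q ! i) x))"
    using int_ind by (subst Bochner_Integration.integral_sum) auto
  also have "\<dots> = (LINT x|\<rho>. indicator S x)"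
    using AE by (intro integral_cong_AE) auto
  finally have mass: "(LINT x|\<rho>. (\<Sum>i<length Q. g i x)) = measure \<rho> S"
    by simp
  have "(LINT x|\<rho>. (\<Sum>i<length Q. g i x) *\<^sub>R x) = (\<Sum>i<length Q. LINT x:S \<inter> Q ! i|\<rho>. x)"
    unfolding scaleR_left.sum using g int
    by (subst Bochner_Integration.integral_sum) (auto simp: moments_match_def)
  also have "\<dots> = (LINT x|\<rho>. (\<Sum>i<length Q. indicat_real (S \<inter> Q ! i) x) *\<^sub>R x)"
    unfolding scaleR_left.sum set_lebesgue_integral_def using int_ind
    by (subst Bochner_Integration.integral_sum) auto
  also have "\<dots> = (LINT x:S|\<rho>. x)"
    unfolding set_lebesgue_integral_def
    using AE by (intro integral_cong_AE) auto
  finally show ?thesis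
    using g mass by (auto simp: moments_match_def intro!: sum_nonneg borel_measurable_sum)
qed

section \<open>Rigidity of Laguerre and hierarchical Laguerre tessellations\<close>

lemma laguerre_rigid:
  assumes Q: "laguerre Q" and S[measurable]: "S \<in> sets borel"
    and g: "\<And>i. i < length Q \<Longrightarrow> moments_match (g i) (S \<inter> Q ! i)"
    and sum_g: "AE x in \<rho>. (\<Sum>i<length Q. g i x) = indicator S x"
    and "i < length Q"
  shows "AE x in \<rho>. g i x = indicator (S \<inter> Q ! i) x"
proof -
  obtain y \<phi> where Q_eq: "Q = map (laguerre_cell y \<phi>) [0..<length y]"
    using Q unfolding laguerre_def by auto
  define n where "n = length Q"
  have n: "n = length y" by (simp add: n_def Q_eq)
  define h where "h = (\<lambda>i x. x \<bullet> (y ! i) - \<phi> ! i)"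
  \<comment> \<open>Membership in cell \<open>i\<close> says that \<open>h i\<close> is maximal at
    \<open>x\<close>; the added case \<open>j = i\<close> is trivial.\<close>
  have cell: "x \<in> Q ! i \<longleftrightarrow> (\<forall>j<n. h j x \<le> h i x)" if "i < n" for i x
    using that by (auto simp: Q_eq laguerre_cell_def h_def n)
  have T: "tessellation Q" using Q by (rule laguerre_tessellation)
  have mQ[measurable]: "Q ! i \<in> sets borel" if "i < n" for i
    using tessellation_measurable[OF T] that by (simp add: n_def)
  have g_nonneg: "0 \<le> g i x" and [measurable]: "g i \<in> borel_measurable borel" if "i < n" for i x
    using g that by (auto simp: moments_match_def n_def)
  have g_le: "AE x in \<rho>. g i x \<le> 1" if "i < n" for i
    using sum_g
  proof eventually_elim
    case (elim x)
    have "g i x \<le> (\<Sum>i<n. g i x)"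
      using that g_nonneg by (intro member_le_sum) auto
    also have "\<dots> \<le> 1" using elim by (simp add: n_def split: split_indicator)
    finally show ?case .
  qed
  have gint: "integrable \<rho> (g i)" "integrable \<rho> (\<lambda>x. g i x *\<^sub>R x)" if "i < n" for i
    using moments_match_integrable[OF g g_le] that by (simp_all add: n_def)
  have iint: "integrable \<rho> (indicat_real (S \<inter> Q ! i))"
    "integrable \<rho> (\<lambda>x. indicat_real (S \<inter> Q ! i) x *\<^sub>R x)" if "i < n" for i
  proof -
    have "S \<inter> Q ! i \<in> sets borel" using that by measurable
    from moments_match_integrable[OF moments_match_indicator[OF this]]
    show "integrable \<rho> (indicat_real (S \<inter> Q ! i))"
      "integrable \<rho> (\<lambda>x. indicat_real (S \<inter> Q ! i) x *\<^sub>R x)"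
      by (simp_all add: indicator_le_1)
  qed
  \<comment> \<open>The deviation of \<open>g i\<close> from the indicator has zero mass and zero
    first moment, so it is orthogonal in \<open>\<rho>\<close> to every affine function, in
    particular to \<open>h i\<close>.\<close>
  define u where "u = (\<lambda>i x. indicat_real (S \<inter> Q ! i) x - g i x)"
  have uint: "integrable \<rho> (u i)" "integrable \<rho> (\<lambda>x. u i x *\<^sub>R x)" if "i < n" for i
    using gint[OF that] iint[OF that] by (auto simp: u_def scaleR_left_diff_distrib)
  have u0: "(LINT x|\<rho>. u i x) = 0" "(LINT x|\<rho>. u i x *\<^sub>R x) = 0" if "i < n" for i
    using gint[OF that] iint[OF that] g[of i] that
    by (auto simp: u_def scaleR_left_diff_distrib moments_match_def n_def set_lebesgue_integral_def)
  have uh: "u i x * h i x = (u i x *\<^sub>R x) \<bullet> (y ! i) - u i x * \<phi> ! i" for i x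
    by (simp add: h_def algebra_simps)
  have uhint: "integrable \<rho> (\<lambda>x. u i x * h i x)" and uh0: "(LINT x|\<rho>. u i x * h i x) = 0"
    if "i < n" for i
    unfolding uh using uint[OF that] u0[OF that] by (auto simp del: inner_scaleR_left)
  have unique: "AE x in \<rho>. \<exists>k<n. \<forall>i<n. x \<in> Q ! i \<longleftrightarrow> i = k"
    using AE_sum_indicator_tessellation[OF T]
  proof eventually_elim
    case (elim x)
    have "real (card {i\<in>{..<n}. x \<in> Q ! i}) = 1"
      using elim by (simp add: n_def indicator_def sum.If_cases Int_def)
    then obtain k where "{i\<in>{..<n}. x \<in> Q ! i} = {k}"
      by (metis card_1_singletonE of_nat_eq_1_iff)
    then show ?case by (intro exI[of _ k]) blast
  qed
  \<comment> \<open>Inside \<open>S\<close> the indicators select the maximal value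
    \<open>h k x\<close>; as the \<open>g i x\<close> have total 1, it can be distributed over them,
    leaving the gaps \<open>h k x - h i x\<close> weighted by \<open>g i x\<close>. Outside
    \<open>S\<close> the nonnegative \<open>g i x\<close> sum to 0, so every term vanishes.\<close>
  have decomp: "AE x in \<rho>. (x \<notin> S \<and> (\<forall>i<n. u i x * h i x = 0 \<and> g i x = 0)) \<or>
      (x \<in> S \<and> (\<exists>k<n. (\<forall>i<n. x \<in> Q ! i \<longleftrightarrow> i = k) \<and>
        (\<Sum>i<n. u i x * h i x) = (\<Sum>i<n. g i x * (h k x - h i x)) \<and> (\<Sum>i<n. g i x) = 1))"
    using unique sum_g
  proof eventually_elim
    case (elim x)
    show ?case
    proof (cases "x \<in> S")
      case True
      obtain k where k: "k < n" "\<forall>i<n. x \<in> Q ! i \<longleftrightarrow> i = k" using elim by auto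
      have s: "(\<Sum>i<n. g i x) = 1" using elim True by (simp add: n_def)
      have "(\<Sum>i<n. u i x * h i x) = (\<Sum>i<n. (if i = k then h i x else 0) - g i x * h i x)"
        using k True by (intro sum.cong) (auto simp: u_def algebra_simps split: split_indicator)
      also have "\<dots> = (\<Sum>i<n. g i x) * h k x - (\<Sum>i<n. g i x * h i x)"
        using k s by (simp add: sum_subtractf)
      also have "\<dots> = (\<Sum>i<n. g i x * (h k x - h i x))"
        by (simp add: sum_subtractf sum_distrib_right right_diff_distrib)
      finally show ?thesis using True k s by blast
    next
      case False
      then have "\<forall>i<n. g i x = 0"
        using elim g_nonneg sum_nonneg_eq_0_iff[of "{..<n}" "\<lambda>i. g i x"] by (simp add: n_def)
      then show ?thesis using False by (simp add: u_def)
    qed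
  qed
  have "AE x in \<rho>. 0 \<le> (\<Sum>i<n. u i x * h i x)"
    using decomp
  proof eventually_elim
    case (elim x)
    then show ?case
    proof (elim disjE conjE exE)
      fix k assume "k < n" "\<forall>i<n. x \<in> Q ! i \<longleftrightarrow> i = k"
        "(\<Sum>i<n. u i x * h i x) = (\<Sum>i<n. g i x * (h k x - h i x))"
      then show ?thesis
        using g_nonneg cell[of k x] by (auto intro!: sum_nonneg mult_nonneg_nonneg)
    next
      assume "\<forall>i<n. u i x * h i x = 0 \<and> g i x = 0"
      then show ?thesis by (intro sum_nonneg) (metis lessThan_iff order_refl)
    qed
  qed
  moreover have "(LINT x|\<rho>. (\<Sum>i<n. u i x * h i x)) = 0"
    using uhint uh0 by (subst Bochner_Integration.integral_sum) auto
  \<comment> \<open>A function that is nonnegative almost everywhere and has integral 0 vanishes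
    almost everywhere.\<close>
  ultimately have "AE x in \<rho>. (\<Sum>i<n. u i x * h i x) = 0"
    using uhint by (subst (asm) integral_nonneg_eq_0_iff_AE) auto
  then have "AE x in \<rho>. \<forall>i<n. g i x = indicator (S \<inter> Q ! i) x"
    using decomp
  proof eventually_elim
    case (elim x)
    from elim(2) show ?case
    proof (elim disjE conjE exE)
      fix k assume xS: "x \<in> S" and k: "k < n" "\<forall>i<n. x \<in> Q ! i \<longleftrightarrow> i = k"
        and eq: "(\<Sum>i<n. u i x * h i x) = (\<Sum>i<n. g i x * (h k x - h i x))"
        and s: "(\<Sum>i<n. g i x) = 1"
      have nn: "\<forall>i<n. 0 \<le> h k x - h i x" using k cell[of k x] by auto
      have z: "\<forall>i<n. g i x * (h k x - h i x) = 0"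
        using eq elim(1) nn g_nonneg sum_nonneg_eq_0_iff[of "{..<n}" "\<lambda>i. g i x * (h k x - h i x)"]
        by simp
      \<comment> \<open>Outside cell \<open>i\<close> some \<open>h j\<close> strictly exceeds
        \<open>h i\<close>, hence so does the maximal \<open>h k\<close>; the gap is positive and
        its weight must be 0.\<close>
      have g0: "g i x = 0" if i: "i < n" "i \<noteq> k" for i
      proof -
        have "x \<notin> Q ! i" using k i by blast
        then obtain j where "j < n" "h i x < h j x" using cell[OF i(1)] by (meson not_le)
        then have "h i x < h k x" using nn by fastforce
        then show ?thesis using z i by auto
      qed
      then have "(\<Sum>i<n. g i x) = (\<Sum>i<n. if i = k then g k x else 0)"
        by (intro sum.cong) auto
      then have "g k x = 1" using s k by simp
      then show ?thesis using g0 k xS by (auto split: split_indicator)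
    qed auto
  qed
  then show ?thesis by eventually_elim (use \<open>i < length Q\<close> in \<open>simp add: n_def\<close>)
qed

text \<open>Induction on the construction of \<open>L\<close>. Pairing every density with its cell
  in one list lets the refinement cut both along the same blocks and lets a relabelling permute both
  at once.\<close>

lemma hier_laguerre_rigid_list:
  assumes "hier_laguerre L" "map snd ps = L" "\<forall>p\<in>set ps. moments_match (fst p) (snd p)"
    and "AE x in \<rho>. (\<Sum>p\<leftarrow>ps. fst p x) = 1" and "p \<in> set ps"
  shows "AE x in \<rho>. fst p x = indicator (snd p) x"
  using assms
proof (induction arbitrary: ps p rule: hier_laguerre.induct)
  case (base L)
  have len: "length ps = length L" and nth: "\<And>i. i < length L \<Longrightarrow> L ! i = snd (ps ! i)"
    using base(2) by auto
  obtain i where i: "i < length L" "p = ps ! i"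
    using base(5) len by (metis in_set_conv_nth)
  \<comment> \<open>A plain Laguerre tessellation is the case of the ambient cell
    \<open>S = UNIV\<close>.\<close>
  have "AE x in \<rho>. fst (ps ! i) x = indicator (UNIV \<inter> L ! i) x"
  proof (rule laguerre_rigid[OF base(1)])
    show "moments_match (fst (ps ! j)) (UNIV \<inter> L ! j)" if "j < length L" for j
      using base(3) that by (simp add: len nth)
    show "AE x in \<rho>. (\<Sum>j<length L. fst (ps ! j) x) = indicator UNIV x"
      using base(4) by (simp add: sum_list_sum_nth len atLeast0LessThan)
  qed (use i in auto)
  then show ?case using i by (simp add: nth)
next
  case (refine P Q i)
  \<comment> \<open>The pairs are split into those before the refined cell, those of its pieces, and
    those after it.\<close>
  obtain p1 qs where qs: "ps = p1 @ qs" and p1: "map snd p1 = take i P"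
    and "map snd qs = map (\<lambda>C. P ! i \<inter> C) Q @ drop (Suc i) P"
    using refine.prems(1)[unfolded map_eq_append_conv] by auto
  then obtain p2 p3 where "qs = p2 @ p3"
    and p2: "map snd p2 = map (\<lambda>C. P ! i \<inter> C) Q" and p3: "map snd p3 = drop (Suc i) P"
    unfolding map_eq_append_conv by auto
  then have ps: "ps = p1 @ p2 @ p3" using qs by simp
  have tP: "tessellation P" using refine.hyps(1) by (rule hier_laguerre_tessellation)
  have tQ: "tessellation Q" using refine.hyps(2) by (rule laguerre_tessellation)
  have S: "P ! i \<in> sets borel" using tessellation_measurable[OF tP] refine.hyps(3) .
  have len: "length p2 = length Q"
    using p2 by (metis length_map)
  have nth: "P ! i \<inter> Q ! j = snd (p2 ! j)" if "j < length Q" for j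
    using p2 that len by (metis nth_map)
  have mm: "moments_match (fst (p2 ! j)) (P ! i \<inter> Q ! j)" if "j < length Q" for j
    using refine.prems(2) that len by (simp add: nth ps)
  have nonneg: "\<forall>p\<in>set ps. \<forall>x. 0 \<le> fst p x"
    using refine.prems(2) by (simp add: moments_match_def)
  have le: "AE x in \<rho>. fst (p2 ! j) x \<le> 1" if "j < length Q" for j
    using refine.prems(3)
  proof eventually_elim
    case (elim x)
    have "fst (p2 ! j) x \<in> set (map (\<lambda>p. fst p x) ps)"
      using that len by (simp add: ps)
    then have "fst (p2 ! j) x \<le> (\<Sum>p\<leftarrow>ps. fst p x)"
      using nonneg by (intro member_le_sum_list) auto
    then show ?case using elim by simp
  qed
  define g where "g x = (\<Sum>j<length Q. fst (p2 ! j) x)" for x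
  have g: "g x = (\<Sum>p\<leftarrow>p2. fst p x)" for x
    by (simp add: g_def sum_list_sum_nth len atLeast0LessThan)
  have mg: "moments_match g (P ! i)"
    unfolding g_def using tQ S mm le by (rule moments_match_merge)
  \<comment> \<open>Replacing the block of pieces by the merged pair gives a competitor for the
    coarser tessellation \<open>P\<close>, to which the induction hypothesis applies.\<close>
  let ?ps' = "p1 @ (g, P ! i) # p3"
  have IH: "AE x in \<rho>. fst q x = indicator (snd q) x" if "q \<in> set ?ps'" for q
  proof (rule refine.IH[OF _ _ _ that])
    show "map snd ?ps' = P"
      using id_take_nth_drop[OF refine.hyps(3)] by (simp add: p1 p3)
    show "\<forall>p\<in>set ?ps'. moments_match (fst p) (snd p)"
      using refine.prems(2) mg by (auto simp: ps)
    show "AE x in \<rho>. (\<Sum>p\<leftarrow>?ps'. fst p x) = 1"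
      using refine.prems(3) by (simp add: ps g)
  qed
  show ?case
  proof (cases "p \<in> set p2")
    case True
    then obtain j where j: "j < length Q" "p = p2 ! j"
      using len by (metis in_set_conv_nth)
    \<comment> \<open>For the merged pair the induction hypothesis says that the densities of the
      pieces sum to the indicator of \<open>P ! i\<close>, which is what Laguerre rigidity inside
      \<open>P ! i\<close> requires.\<close>
    have "AE x in \<rho>. (\<Sum>j<length Q. fst (p2 ! j) x) = indicator (P ! i) x"
      using IH[of "(g, P ! i)"] by (simp add: g_def)
    from laguerre_rigid[OF refine.hyps(2) S mm this j(1)] show ?thesis
      by (simp add: j nth)
  next
    case False
    then show ?thesis using refine.prems(4) by (intro IH) (auto simp: ps)
  qed
next
  case (relabel P P')
  have "mset P = mset (map snd ps)"
    using relabel.hyps(2) relabel.prems(1) by simp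
  \<comment> \<open>A permutation undoing the relabelling of the cells is applied to the whole
    pairs; the sum of the densities is invariant under it.\<close>
  then obtain \<pi> where \<pi>: "\<pi> permutes {..<length (map snd ps)}"
    "permute_list \<pi> (map snd ps) = P"
    using mset_eq_permutation by metis
  define ps' where "ps' = permute_list \<pi> ps"
  have *: "mset ps' = mset ps" unfolding ps'_def using \<pi>(1) by simp
  have set: "set ps' = set ps" using * by (rule mset_eq_setD)
  have sum: "(\<Sum>p\<leftarrow>ps'. f p) = (\<Sum>p\<leftarrow>ps. f p)" for f :: "_ \<Rightarrow> real"
    using * by (metis mset_map sum_mset_sum_list)
  show ?case
  proof (rule relabel.IH)
    show "map snd ps' = P" unfolding ps'_def using \<pi> by (simp add: permute_list_map)
  qed (use relabel.prems in \<open>simp_all add: set sum\<close>)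
qed

lemma hier_laguerre_rigid:
  assumes "hier_laguerre L" "\<And>i. i < length L \<Longrightarrow> moments_match (g i) (L ! i)"
    and "AE x in \<rho>. (\<Sum>i<length L. g i x) = 1" and "i < length L"
  shows "AE x in \<rho>. g i x = indicator (L ! i) x"
proof -
  let ?ps = "map (\<lambda>i. (g i, L ! i)) [0..<length L]"
  have "AE x in \<rho>. fst (g i, L ! i) x = indicator (snd (g i, L ! i)) x"
  proof (rule hier_laguerre_rigid_list[OF assms(1)])
    show "map snd ?ps = L" by (simp add: comp_def map_nth)
    show "AE x in \<rho>. (\<Sum>p\<leftarrow>?ps. fst p x) = 1"
      using assms(3) by (simp add: comp_def sum_list_sum_nth atLeast0LessThan)
  qed (use assms in auto)
  then show ?thesis by simp
qed

section \<open>Uniqueness of tessellations and of decompositions of \<open>\<rho>\<close>\<close>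

lemma hier_laguerre_unique_tessellation:
  assumes L: "hier_laguerre L" "has_volumes_barycenters \<rho> v B L"
    and P: "tessellation P" "has_volumes_barycenters \<rho> v B P"
    and v: "\<And>i. i < length v \<Longrightarrow> 0 < v ! i"
  shows "agree_upto_null \<rho> P L"
  unfolding agree_upto_null_def
proof (intro conjI allI impI)
  have len: "length L = length v" "length P = length v"
    using L P by (auto simp: has_volumes_barycenters_def)
  then show "length P = length L" by simp
  have meas: "P ! i \<in> sets borel" "L ! i \<in> sets borel" if "i < length v" for i
    using tessellation_measurable[OF P(1)] that
      tessellation_measurable[OF hier_laguerre_tessellation[OF L(1)]] by (auto simp: len)
  \<comment> \<open>The competing densities are the indicators of the cells of \<open>P\<close>;
    equality of barycenters becomes equality of first moments once the factor
    \<open>1 / v ! i\<close> is cancelled.\<close>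
  have mm: "moments_match (indicator (P ! i)) (L ! i)" if "i < length L" for i
  proof -
    have i: "i < length v" using that len by simp
    have "measure \<rho> (P ! i) = measure \<rho> (L ! i)"
      "(1 / v ! i) *\<^sub>R (LINT x:P ! i|\<rho>. x) = (1 / v ! i) *\<^sub>R (LINT x:L ! i|\<rho>. x)"
      using L(2) P(2) i by (auto simp: has_volumes_barycenters_def)
    then show ?thesis
      using moments_match_indicator[OF meas(1)[OF i]] v[OF i] by (simp add: moments_match_def)
  qed
  have sum: "AE x in \<rho>. (\<Sum>i<length L. indicat_real (P ! i) x) = 1"
    using AE_sum_indicator_tessellation[OF P(1)] by (simp add: len)
  fix i assume "i < length P"
  then have i: "i < length v" by (simp add: len)
  have "AE x in \<rho>. indicat_real (P ! i) x = indicator (L ! i) x"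
    using hier_laguerre_rigid[OF L(1) mm sum] i by (simp add: len)
  then have "AE x in \<rho>. x \<notin> sym_diff (P ! i) (L ! i)"
    by eventually_elim (auto split: split_indicator_asm)
  then show "sym_diff (P ! i) (L ! i) \<in> null_sets \<rho>"
    using meas[OF i] by (subst (asm) AE_iff_null_sets[symmetric]) auto
qed

text \<open>The property of the families in the theorem, with \<open>length v\<close> in place of
  \<open>N\<close>. The identity between measures is tested on Borel sets by real values, all
  measures involved being finite.\<close>

definition splits :: "real list \<Rightarrow> 'a list \<Rightarrow> 'a measure list \<Rightarrow> bool" where
  "splits v B \<theta> \<longleftrightarrow> length \<theta> = length v \<and> set \<theta> \<subseteq> P1 \<and>
    (\<forall>A\<in>sets borel. (\<Sum>i<length v. v ! i * measure (\<theta> ! i) A) = measure \<rho> A) \<and>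
    (\<forall>i<length v. (LINT x|(\<theta> ! i). x) = B ! i)"

text \<open>Since \<open>v ! i\<close> times \<open>\<theta> ! i\<close> is bounded by
  \<open>\<rho>\<close> on every Borel set and \<open>v ! i\<close> is positive,
  \<open>\<rho>\<close>-null sets are null for \<open>\<theta> ! i\<close>. Radon-Nikodym then gives
  a density, which may be chosen real-valued because \<open>\<theta> ! i\<close> is finite.\<close>

lemma splits_density:
  assumes \<theta>: "splits v B \<theta>" and v: "\<And>i. i < length v \<Longrightarrow> 0 < v ! i" and "i < length v"
  obtains D :: "'a \<Rightarrow> real" where "D \<in> borel_measurable borel" "\<And>x. 0 \<le> D x"
    "\<theta> ! i = density \<rho> (\<lambda>x. ennreal (D x))"
proof -
  have P1: "\<theta> ! j \<in> P1" if "j < length v" for j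
    using \<theta> that by (auto simp: splits_def)
  interpret \<theta>i: prob_space "\<theta> ! i"
    using P1[OF assms(3)] by (simp add: P1_def)
  have sets: "sets (\<theta> ! i) = sets \<rho>"
    using P1[OF assms(3)] by (simp add: P1_def)
  have ac: "absolutely_continuous \<rho> (\<theta> ! i)"
    unfolding absolutely_continuous_def
  proof
    fix A assume A: "A \<in> null_sets \<rho>"
    then have "A \<in> sets borel" "measure \<rho> A = 0"
      by (auto simp: null_sets_def measure_def)
    then have "(\<Sum>j<length v. v ! j * measure (\<theta> ! j) A) = 0"
      using \<theta> by (simp add: splits_def)
    moreover have "v ! i * measure (\<theta> ! i) A \<le> (\<Sum>j<length v. v ! j * measure (\<theta> ! j) A)"
      using assms(3) v by (intro member_le_sum) (auto simp: less_imp_le)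
    ultimately have "measure (\<theta> ! i) A = 0"
      using v[OF assms(3)] by (simp add: mult_le_0_iff measure_le_0_iff)
    then show "A \<in> null_sets (\<theta> ! i)"
      using \<open>A \<in> sets borel\<close> sets by (auto simp: null_sets_def \<theta>i.emeasure_eq_measure)
  qed
  obtain D where D: "D \<in> borel_measurable \<rho>" "AE x in \<rho>. RN_deriv \<rho> (\<theta> ! i) x = ennreal (D x)"
    "\<And>x. 0 \<le> D x"
    using real_RN_deriv[OF \<theta>i.finite_measure_axioms ac sets] by metis
  have "\<theta> ! i = density \<rho> (RN_deriv \<rho> (\<theta> ! i))"
    using density_RN_deriv[OF ac sets] by simp
  also have "\<dots> = density \<rho> (\<lambda>x. ennreal (D x))"
    using D by (intro density_cong) auto
  finally show ?thesis using that[of D] D by simp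
qed

text \<open>The functions \<open>v ! j * D j x\<close>, with \<open>D j\<close> the density of
  \<open>\<theta> ! j\<close>, form a competitor for \<open>L\<close>, so rigidity identifies them
  with the indicators of the cells.\<close>

lemma splits_unique:
  assumes L: "hier_laguerre L" "has_volumes_barycenters \<rho> v B L"
    and v: "\<And>i. i < length v \<Longrightarrow> 0 < v ! i"
    and \<theta>: "splits v B \<theta>" and "i < length v"
  shows "\<theta> ! i = density \<rho> (\<lambda>x. ennreal (indicator (L ! i) x / v ! i))"
proof -
  have len: "length L = length v" using L by (auto simp: has_volumes_barycenters_def)
  have Lm: "L ! j \<in> sets borel" if "j < length v" for j
    using tessellation_measurable[OF hier_laguerre_tessellation[OF L(1)]] that by (simp add: len)
  have "\<forall>j. \<exists>D. j < length v \<longrightarrow> D \<in> borel_measurable borel \<and> (\<forall>x. 0 \<le> D x) \<and>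
    \<theta> ! j = density \<rho> (\<lambda>x. ennreal (D x))"
    using splits_density[OF \<theta> v] by metis
  then obtain D :: "nat \<Rightarrow> 'a \<Rightarrow> real" where D:
    "\<And>j. j < length v \<Longrightarrow> D j \<in> borel_measurable borel" "\<And>j x. j < length v \<Longrightarrow> 0 \<le> D j x"
    "\<And>j. j < length v \<Longrightarrow> \<theta> ! j = density \<rho> (\<lambda>x. ennreal (D j x))"
    by metis
  have prob: "prob_space (\<theta> ! j)" "sets (\<theta> ! j) = sets borel" if "j < length v" for j
  proof -
    have "\<theta> ! j \<in> P1" using \<theta> that by (auto simp: splits_def)
    then show "prob_space (\<theta> ! j)" "sets (\<theta> ! j) = sets borel" by (simp_all add: P1_def)
  qed
  have transfer: "(LINT x|(\<theta> ! j). f x) = (LINT x|\<rho>. D j x *\<^sub>R f x)"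
    if "j < length v" "f \<in> borel_measurable borel" for j and f :: "'a \<Rightarrow> 'b::{banach, second_countable_topology}"
    using that D by (simp add: integral_density)
  have int_D: "integrable \<rho> (D j)" if "j < length v" for j
  proof -
    interpret \<theta>j: prob_space "\<theta> ! j" using prob[OF that] by simp
    have "integrable (\<theta> ! j) (\<lambda>x. 1 :: real)" by simp
    then show ?thesis
      unfolding D(3)[OF that] using D that by (subst (asm) integrable_density) auto
  qed
  have measure_D: "measure (\<theta> ! j) A = (LINT x:A|\<rho>. D j x)"
    if "j < length v" "A \<in> sets borel" for j A
  proof -
    have "measure (\<theta> ! j) A = (LINT x|(\<theta> ! j). indicat_real A x)"
      using that prob[OF that(1)] sets_eq_imp_space_eq[OF prob(2)[OF that(1)]] by simp
    then show ?thesis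
      using transfer[of j "indicat_real A"] that
      by (simp add: set_lebesgue_integral_def mult.commute)
  qed
  \<comment> \<open>Both sides have the same integral \<open>measure \<rho> A\<close> over every
    Borel set \<open>A\<close>, hence agree almost everywhere.\<close>
  have sum: "AE x in \<rho>. (\<Sum>j<length v. v ! j * D j x) = 1"
  proof (rule density_unique_real)
    show "integrable \<rho> (\<lambda>x. \<Sum>j<length v. v ! j * D j x)"
      using int_D by auto
    fix A assume "A \<in> events"
    then have A: "A \<in> sets borel" by simp
    have int: "integrable \<rho> (\<lambda>x. indicat_real A x *\<^sub>R (v ! j * D j x))" if "j < length v" for j
      using int_D[OF that] A by (intro integrable_mult_indicator) auto
    have "(LINT x:A|\<rho>. (\<Sum>j<length v. v ! j * D j x)) =
      (\<Sum>j<length v. v ! j * (LINT x:A|\<rho>. D j x))"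
      unfolding set_lebesgue_integral_def scaleR_sum_right
      using int by (subst Bochner_Integration.integral_sum)
        (auto simp: mult.left_commute simp flip: integral_mult_right_zero)
    also have "\<dots> = (\<Sum>j<length v. v ! j * measure (\<theta> ! j) A)"
      using A by (intro sum.cong) (auto simp: measure_D)
    also have "\<dots> = measure \<rho> A" using \<theta> A by (simp add: splits_def)
    finally show "(LINT x:A|\<rho>. (\<Sum>j<length v. v ! j * D j x)) = (LINT x:A|\<rho>. 1)"
      using A by (simp add: set_lebesgue_integral_def)
  qed auto
  have "AE x in \<rho>. v ! i * D i x = indicator (L ! i) x"
  proof (rule hier_laguerre_rigid[OF L(1)])
    show "AE x in \<rho>. (\<Sum>j<length L. v ! j * D j x) = 1"
      using sum by (simp add: len)
    fix j assume "j < length L"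
    then have j: "j < length v" by (simp add: len)
    \<comment> \<open>Since \<open>\<theta> ! j\<close> is a probability measure, the rescaled
      density has mass \<open>v ! j\<close>, the volume of \<open>L ! j\<close>.\<close>
    have "(LINT x|\<rho>. D j x) = 1"
      using measure_D[OF j, of UNIV] prob_space.prob_space[OF prob(1)[OF j]]
        sets_eq_imp_space_eq[OF prob(2)[OF j]] by (simp add: set_lebesgue_integral_def)
    then have mass: "(LINT x|\<rho>. v ! j * D j x) = measure \<rho> (L ! j)"
      using L(2) j by (simp add: has_volumes_barycenters_def)
    have "(LINT x|\<rho>. D j x *\<^sub>R x) = (1 / v ! j) *\<^sub>R (LINT x:L ! j|\<rho>. x)"
      using transfer[OF j, of "\<lambda>x. x"] \<theta> L(2) j
      by (simp add: splits_def has_volumes_barycenters_def)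
    then have "v ! j *\<^sub>R (LINT x|\<rho>. D j x *\<^sub>R x) = (LINT x:L ! j|\<rho>. x)"
      using v[OF j] by simp
    then have "(LINT x|\<rho>. (v ! j * D j x) *\<^sub>R x) = (LINT x:L ! j|\<rho>. x)"
      by (simp flip: scaleR_scaleR)
    then show "moments_match (\<lambda>x. v ! j * D j x) (L ! j)"
      using D[OF j] v[OF j] mass by (auto simp: moments_match_def intro!: mult_nonneg_nonneg)
  qed (use assms(5) len in simp)
  then have "AE x in \<rho>. ennreal (D i x) = ennreal (indicator (L ! i) x / v ! i)"
  proof eventually_elim
    case (elim x)
    then have "D i x = indicator (L ! i) x / v ! i"
      using v[OF assms(5)] by (simp add: eq_divide_eq mult.commute)
    then show ?case by simp
  qed
  then show ?thesis
    unfolding D(3)[OF assms(5)] using D(1)[OF assms(5)] Lm[OF assms(5)]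
    by (intro density_cong) auto
qed

text \<open>Existence: the normalised restrictions of \<open>\<rho>\<close> to the cells have the
  prescribed barycenters, and they recombine to \<open>\<rho>\<close> because the overlaps of the
  cells are null.\<close>

lemma splits_cell_densities:
  assumes L: "tessellation L" "has_volumes_barycenters \<rho> v B L"
    and v: "\<And>i. i < length v \<Longrightarrow> 0 < v ! i"
  shows "splits v B (map (\<lambda>i. density \<rho> (\<lambda>x. ennreal (indicator (L ! i) x / v ! i))) [0..<length v])"
    (is "splits v B (map ?\<theta> _)")
proof -
  have len: "length L = length v" using L by (auto simp: has_volumes_barycenters_def)
  have Lm[measurable]: "L ! j \<in> sets borel" if "j < length v" for j
    using tessellation_measurable[OF L(1)] that by (simp add: len)
  have emeas: "emeasure (?\<theta> j) A = ennreal (measure \<rho> (L ! j \<inter> A) / v ! j)"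
    if j: "j < length v" and A: "A \<in> sets borel" for j A
  proof -
    have "emeasure (?\<theta> j) A = (\<integral>\<^sup>+x. ennreal (1 / v ! j) * indicator (L ! j \<inter> A) x \<partial>\<rho>)"
      using j A Lm[OF j] by (subst emeasure_density)
        (auto intro!: nn_integral_cong split: split_indicator)
    also have "\<dots> = ennreal (1 / v ! j) * ennreal (measure \<rho> (L ! j \<inter> A))"
      using j A Lm[OF j] by (subst nn_integral_cmult_indicator) (auto simp: emeasure_eq_measure)
    also have "\<dots> = ennreal (measure \<rho> (L ! j \<inter> A) / v ! j)"
      using v[OF j] by (simp flip: ennreal_mult)
    finally show ?thesis .
  qed
  have meas: "measure (?\<theta> j) A = measure \<rho> (L ! j \<inter> A) / v ! j"
    if "j < length v" "A \<in> sets borel" for j A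
    using emeas[OF that] v[OF that(1)] by (simp add: measure_def)
  have "?\<theta> j \<in> P1" if j: "j < length v" for j
  proof -
    have "measure \<rho> (L ! j) = v ! j" using L(2) j by (simp add: has_volumes_barycenters_def)
    then have "emeasure (?\<theta> j) (space (?\<theta> j)) = 1"
      using emeas[OF j, of UNIV] v[OF j] by simp
    moreover have "integrable (?\<theta> j) norm"
    proof -
      have "integrable \<rho> (\<lambda>x. (1 / v ! j) * (indicator (L ! j) x *\<^sub>R norm x))"
        using integrable_norm_rho Lm[OF j]
        by (intro integrable_mult_right integrable_mult_indicator) auto
      then show ?thesis
        using v[OF j] Lm[OF j] by (subst integrable_density) auto
    qed
    ultimately show ?thesis by (auto simp: P1_def intro: prob_spaceI)
  qed
  moreover have "(\<Sum>i<length v. v ! i * measure (?\<theta> i) A) = measure \<rho> A"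
    if A[measurable]: "A \<in> sets borel" for A
  proof -
    have AE: "AE x in \<rho>. (\<Sum>i<length v. indicator (L ! i \<inter> A) x) = indicat_real A x"
      using AE_sum_indicator_tessellation[OF L(1)]
      by eventually_elim (simp add: len indicator_inter_arith flip: sum_distrib_right)
    have "(\<Sum>i<length v. v ! i * measure (?\<theta> i) A) = (\<Sum>i<length v. measure \<rho> (L ! i \<inter> A))"
    proof (rule sum.cong)
      fix i assume "i \<in> {..<length v}"
      then show "v ! i * measure (?\<theta> i) A = measure \<rho> (L ! i \<inter> A)"
        using v[of i] meas[OF _ A, of i] by simp
    qed simp
    also have "\<dots> = (LINT x|\<rho>. (\<Sum>i<length v. indicator (L ! i \<inter> A) x))"
      using A Lm by (subst Bochner_Integration.integral_sum)
        (auto simp: emeasure_eq_measure intro!: integrable_real_indicator)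
    also have "\<dots> = (LINT x|\<rho>. indicator A x)"
      using AE by (intro integral_cong_AE) auto
    finally show ?thesis by simp
  qed
  moreover have "(LINT x|?\<theta> i. x) = B ! i" if i: "i < length v" for i
  proof -
    have "(LINT x|?\<theta> i. x) = (LINT x|\<rho>. (1 / v ! i) *\<^sub>R (indicator (L ! i) x *\<^sub>R x))"
      using v[OF i] Lm[OF i] by (subst integral_density) (auto simp: mult.commute)
    also have "\<dots> = B ! i"
      using L(2) i unfolding has_volumes_barycenters_def set_lebesgue_integral_def
      by (subst integral_scaleR_right) simp
    finally show ?thesis .
  qed
  ultimately show ?thesis
    by (auto simp: splits_def)
qed

end

section \<open>Agreement up to null sets and conclusion\<close>

lemma agree_upto_null_sym:
  "agree_upto_null \<rho> P P' \<Longrightarrow> agree_upto_null \<rho> P' P"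
  by (simp add: agree_upto_null_def Un_commute)

text \<open>The symmetric difference of the outer sets lies in the union of the two given ones.
  Measurability is assumed since \<open>null_sets\<close> contains only measurable sets and
  \<open>\<rho>\<close> need not be complete.\<close>

lemma agree_upto_null_trans:
  assumes "agree_upto_null \<rho> P Q" "agree_upto_null \<rho> Q R"
    and "\<And>i. i < length P \<Longrightarrow> P ! i \<in> sets \<rho>" "\<And>i. i < length P \<Longrightarrow> R ! i \<in> sets \<rho>"
  shows "agree_upto_null \<rho> P R"
proof -
  have "sym_diff (P ! i) (R ! i) \<in> null_sets \<rho>" if i: "i < length P" for i
  proof (rule null_sets_subset)
    have "sym_diff (P ! i) (Q ! i) \<in> null_sets \<rho>" "sym_diff (Q ! i) (R ! i) \<in> null_sets \<rho>"
      using assms(1,2) i by (simp_all add: agree_upto_null_def)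
    then show "sym_diff (P ! i) (Q ! i) \<union> sym_diff (Q ! i) (R ! i) \<in> null_sets \<rho>"
      by (rule null_sets.Un)
    show "sym_diff (P ! i) (R ! i) \<in> sets \<rho>"
      using assms(3,4) i by auto
  qed auto
  then show ?thesis using assms(1,2) by (simp add: agree_upto_null_def)
qed

theorem proposition3p4:
  fixes N :: nat and \<rho> :: "(real ^ 'd) measure" and v :: "real list" and B :: "(real ^ 'd) list"
  assumes "N \<ge> 1"
    and "\<rho> \<in> P1" and "bounded_density \<rho>"
    and "length v = N" and "\<forall>i<N. v ! i > 0" and "(\<Sum>i<N. v ! i) = 1"
    and "B \<in> B_hLag N v \<rho>"
  shows "(\<exists>!\<theta>. length \<theta> = N \<and> set \<theta> \<subseteq> P1 \<and>
            (\<forall>A\<in>sets borel. (\<Sum>i<N. v ! i * measure (\<theta> ! i) A) = measure \<rho> A) \<and>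
            (\<forall>i<N. (LINT x|(\<theta> ! i). x) = B ! i)) \<and>
         (\<exists>P. tessellation P \<and> has_volumes_barycenters \<rho> v B P) \<and>
         (\<forall>P P'. tessellation P \<and> has_volumes_barycenters \<rho> v B P \<and>
                 tessellation P' \<and> has_volumes_barycenters \<rho> v B P' \<longrightarrow>
                 agree_upto_null \<rho> P P') \<and>
         (\<forall>P. tessellation P \<and> has_volumes_barycenters \<rho> v B P \<longrightarrow>
              (\<exists>L. hier_laguerre L \<and> agree_upto_null \<rho> P L))"
proof -
  interpret ac_P1 \<rho>
  proof
    show "\<rho> \<in> P1" by fact
    show "absolutely_continuous lborel \<rho>"
      using assms(3) unfolding bounded_density_def
      by (auto intro!: absolutely_continuousI_density)
  qed
  obtain L where L: "hier_laguerre L" "has_volumes_barycenters \<rho> v B L"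
    using assms(7) by (auto simp: B_hLag_def)
  have tL: "tessellation L" using L(1) by (rule hier_laguerre_tessellation)
  have v: "\<And>i. i < length v \<Longrightarrow> 0 < v ! i" using assms(4,5) by simp
  have "\<exists>!\<theta>. splits v B \<theta>"
  proof (rule ex1I)
    show "splits v B (map (\<lambda>i. density \<rho> (\<lambda>x. ennreal (indicator (L ! i) x / v ! i))) [0..<length v])"
      using tL L(2) v by (rule splits_cell_densities)
    show "\<theta> = map (\<lambda>i. density \<rho> (\<lambda>x. ennreal (indicator (L ! i) x / v ! i))) [0..<length v]"
      if "splits v B \<theta>" for \<theta>
      using splits_unique[OF L v that] that by (intro nth_equalityI) (auto simp: splits_def)
  qed
  \<comment> \<open>Every tessellation with the given data is compared with the single hierarchical
    tessellation \<open>L\<close>; this yields the last claim directly, and uniqueness by passing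
    from \<open>P\<close> to \<open>P'\<close> through \<open>L\<close>.\<close>
  moreover have near_L: "agree_upto_null \<rho> P L"
    if "tessellation P" "has_volumes_barycenters \<rho> v B P" for P
    using hier_laguerre_unique_tessellation[OF L that v] .
  moreover have "agree_upto_null \<rho> P P'"
    if P: "tessellation P" "has_volumes_barycenters \<rho> v B P"
      and P': "tessellation P'" "has_volumes_barycenters \<rho> v B P'" for P P'
  proof (rule agree_upto_null_trans)
    show "agree_upto_null \<rho> P L" using P by (rule near_L)
    show "agree_upto_null \<rho> L P'" using near_L[OF P'] by (rule agree_upto_null_sym)
    have "length P' = length P"
      using P(2) P'(2) by (simp add: has_volumes_barycenters_def)
    then show "P' ! i \<in> sets \<rho>" "P ! i \<in> sets \<rho>" if "i < length P" for i
      using that tessellation_measurable[OF P(1)] tessellation_measurable[OF P'(1)] by auto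
  qed
  ultimately show ?thesis
    using L tL unfolding splits_def assms(4) by blast
qed

end
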